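(* Let $q$ be a prime power, let $t$ be an involution in $G=\mathrm{PSL}(2,q)$ and let $C=C_G(t)$ be its centralizer in $G$. Then each coset $Cx$ ($x\in G$) contains an element of odd order.
   Context: $\mathrm{PSL}(2,q)$ denotes the projective special linear group of degree 2 over the finite field with $q$ elements. An involution is an element of order exactly $2$. Cosets are written as $Cx=\{cx\mid c\in C\}$. The identity has order $1$, which is odd. *)

theory Defs
  imports "HOL-Analysis.Analysis" "HOL-Algebra.Algebra" "HOL-Number_Theory.Prime_Powers"
begin

definition group_center :: "('a, 'b) monoid_scheme \<Rightarrow> 'a set" where
  "group_center G = {z \<in> carrier G. \<forall>g \<in> carrier G. z \<otimes>\<^bsub>G\<^esub> g = g \<otimes>\<^bsub>G\<^esub> z}"

definition element_centralizer :: "('a, 'b) monoid_scheme \<Rightarrow> 'a \<Rightarrow> 'a set" where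
  "element_centralizer G t = {g \<in> carrier G. g \<otimes>\<^bsub>G\<^esub> t = t \<otimes>\<^bsub>G\<^esub> g}"

definition SL :: "('a::field ^ 'n ^ 'n) monoid" where
  "SL = \<lparr>carrier = {A. det A = 1}, mult = (**), one = mat 1\<rparr>"

text \<open>
  The size of the matrices is the cardinality of the index type \<open>'n\<close>; thus \<open>PSL(2,q)\<close> is
  \<open>PSL :: ('a ^ 2 ^ 2) set monoid\<close> for a finite field \<open>'a\<close> with \<open>q\<close> elements. The group
  elements are the cosets of the center of \<open>SL\<close>.
\<close>

definition PSL :: "('a::field ^ 'n ^ 'n) set monoid" where
  "PSL = SL Mod group_center SL"

lemma group_center_normal:
  fixes G (structure)
  assumes "group G"
  shows "group_center G \<lhd> G"
proof -
  interpret group G by fact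
  have sub: "group_center G \<subseteq> carrier G"
    by (auto simp: group_center_def)
  have comm: "z \<otimes> g = g \<otimes> z" if "z \<in> group_center G" "g \<in> carrier G" for z g
    using that by (simp add: group_center_def)
  have "subgroup (group_center G) G"
  proof (rule subgroupI)
    show "group_center G \<noteq> {}"
      using one_closed by (force simp: group_center_def)
  next
    fix a assume a: "a \<in> group_center G"
    have "inv a \<otimes> g = g \<otimes> inv a" if g: "g \<in> carrier G" for g
    proof -
      have "inv (inv g \<otimes> a) = inv (a \<otimes> inv g)"
        using comm[OF a, of "inv g"] g by simp
      then show ?thesis
        using a g sub by (simp add: inv_mult_group subset_iff)
    qed
    then show "inv a \<in> group_center G"
      using a by (auto simp: group_center_def)
  next
    fix a b assume a: "a \<in> group_center G" and b: "b \<in> group_center G"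
    have "(a \<otimes> b) \<otimes> g = g \<otimes> (a \<otimes> b)" if g: "g \<in> carrier G" for g
    proof -
      have ab: "a \<in> carrier G" "b \<in> carrier G"
        using a b sub by auto
      have "(a \<otimes> b) \<otimes> g = a \<otimes> (g \<otimes> b)"
        using ab g by (simp add: m_assoc comm[OF b g])
      also have "\<dots> = (g \<otimes> a) \<otimes> b"
        using ab g by (simp add: m_assoc[symmetric] comm[OF a g])
      finally show ?thesis
        using ab g by (simp add: m_assoc)
    qed
    moreover have "a \<otimes> b \<in> carrier G"
      using a b sub by blast
    ultimately show "a \<otimes> b \<in> group_center G"
      unfolding group_center_def by blast
  qed (rule sub)
  moreover have "x \<otimes> z \<otimes> inv x \<in> group_center G"
    if x: "x \<in> carrier G" and z: "z \<in> group_center G" for x z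
  proof -
    have zc: "z \<in> carrier G"
      using z sub by auto
    have "x \<otimes> z \<otimes> inv x = z \<otimes> x \<otimes> inv x"
      by (simp only: comm[OF z x])
    also have "\<dots> = z"
      using x zc by (simp add: m_assoc)
    finally show ?thesis
      using z by simp
  qed
  ultimately show ?thesis
    by (simp only: normal_inv_iff) blast
qed

lemma group_SL: "group (SL :: ('a::field ^ 'n ^ 'n) monoid)"
proof (rule groupI)
  fix A :: "'a ^ 'n ^ 'n"
  assume "A \<in> carrier SL"
  then have "det A = 1" by (simp add: SL_def)
  then have "invertible A" by (simp add: invertible_det_nz)
  then obtain B where B: "A ** B = mat 1" "B ** A = mat 1"
    unfolding invertible_def by blast
  have "det B = 1"
    using arg_cong[OF B(1), of det] \<open>det A = 1\<close> by (simp add: det_mul)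
  with B show "\<exists>B \<in> carrier SL. B \<otimes>\<^bsub>SL\<^esub> A = \<one>\<^bsub>SL\<^esub>"
    by (auto simp: SL_def)
qed (simp_all add: SL_def det_mul matrix_mul_assoc)

lemma group_PSL: "group (PSL :: ('a::field ^ 'n ^ 'n) set monoid)"
  unfolding PSL_def by (intro normal.factorgroup_is_group group_center_normal group_SL)

end

theory Submission
  imports Defs "HOL-Number_Theory.Residues" "HOL-Computational_Algebra.Polynomial_Factorial"
begin

text \<open>
  Lift the involution \<open>t\<close> to a matrix \<open>T\<close> in \<open>SL(2,q)\<close>. The centre is \<open>{1, -1}\<close>, so
  \<open>T\<^sup>2\<close> is \<open>1\<close> or \<open>-1\<close>. For odd \<open>q\<close>, \<open>T\<^sup>2 = 1\<close> would force \<open>T = 1\<close> or \<open>T = -1\<close>. Hence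
  \<open>T\<^sup>2 = -1\<close> in all cases, and \<open>T\<close> has trace 0. The centralizer \<open>C\<close> of \<open>t\<close> consists of the classes of the matrices
  that commute or anticommute with \<open>T\<close>. The class of a matrix \<open>A\<close> has odd order iff an odd
  power of \<open>A\<close> is \<open>1\<close> or \<open>-1\<close>, and sufficient conditions for this can be read off from the trace of
  \<open>A\<close>. So the question becomes which traces occur in the coset of a given matrix \<open>W\<close>.

  \<^bold>\<open>Orders.\<close> The characteristic polynomial of \<open>A\<close> is \<open>P = X\<^sup>2 - (trace A) X + 1\<close>. If \<open>P\<close> has two
  distinct roots in the field, then \<open>A ^ (q - 1) = 1\<close>; if it has a double root, then \<open>A ^ q\<close> is
  \<open>1\<close> or \<open>-1\<close>; if it is irreducible, then \<open>A ^ (q + 1) = 1\<close>, because the Frobenius map exchanges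
  the roots of \<open>P\<close>. For odd \<open>q\<close>, the only square roots of \<open>1\<close> in \<open>SL(2,q)\<close> are \<open>1\<close> and \<open>-1\<close>, so
  the exponents \<open>q - 1\<close> and \<open>q + 1\<close> may be halved modulo the centre. Hence the class of \<open>A\<close> has
  odd order if \<open>q\<close> is even and the trace is not 0; if \<open>q\<close> is odd and the trace is 2 or -2; if
  \<open>q mod 4 = 3\<close> and \<open>(trace A)\<^sup>2 - 4\<close> is a square; and if \<open>q mod 4 = 1\<close> and
  \<open>(trace A)\<^sup>2 - 4\<close> is not a square.

  \<^bold>\<open>Traces in the coset.\<close> Let \<open>M = (trace W)\<^sup>2 + (trace (T W))\<^sup>2\<close>. The matrices \<open>a + b T\<close> with
  \<open>a\<^sup>2 + b\<^sup>2 = 1\<close> have determinant 1 and commute with \<open>T\<close>. If \<open>M \<noteq> 0\<close>, then multiplying \<open>W\<close> by them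
  produces every trace \<open>\<tau>\<close> for which \<open>M - \<tau>\<^sup>2\<close> is a square
  (\<open>commuting_multiple_with_trace\<close>). Anticommuting matrices exchange the roles of \<open>M\<close> and
  \<open>4 - M\<close>; only the trace 2 is wanted from them, and it occurs if \<open>-M\<close> is a square and \<open>M \<noteq> 4\<close>
  (\<open>anticommuting_multiple_with_trace_2\<close>).

  \<^bold>\<open>Conclusion for odd \<open>q\<close>.\<close> Suppose \<open>q mod 4 = 1\<close>, so that \<open>-1\<close> is a square. If \<open>M\<close> or \<open>M - 4\<close>
  is a square, the trace 2 occurs. If neither is a square, counting shows that there are more
  \<open>\<tau>\<close> with \<open>\<tau>\<^sup>2 - M\<close> a nonzero square than with \<open>\<tau>\<^sup>2 - 4\<close> a nonzero square, and this yields a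
  suitable \<open>\<tau>\<close> (\<open>exists_elliptic_trace\<close>). Suppose \<open>q mod 4 = 3\<close>. If \<open>M = 0\<close>, the trace 2
  occurs; otherwise a similar count gives \<open>\<tau>\<close> such that \<open>M - \<tau>\<^sup>2\<close> and \<open>\<tau>\<^sup>2 - 4\<close> are both squares
  (\<open>exists_hyperbolic_trace\<close>).

  \<^bold>\<open>Conclusion for even \<open>q\<close>.\<close> If \<open>W\<close> or \<open>T W\<close> has nonzero trace, it is the required element. If
  both traces are 0, then \<open>W\<close> commutes with \<open>T\<close> (\<open>anticommute_if_traces_zero\<close>), and the coset is \<open>C\<close>
  itself.
\<close>

section \<open>Two-by-two matrices\<close>

definition mat2 :: "'a \<Rightarrow> 'a \<Rightarrow> 'a \<Rightarrow> 'a \<Rightarrow> 'a::zero ^ 2 ^ 2" where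
  "mat2 a b c d = vector [vector [a, b], vector [c, d]]"

lemma mat2_exhaust:
  obtains a b c d where "A = mat2 a b c d"
proof
  show "A = mat2 (A $ 1 $ 1) (A $ 1 $ 2) (A $ 2 $ 1) (A $ 2 $ 2)"
    by (simp add: mat2_def vec_eq_iff forall_2)
qed

lemma mat2_eq_iff: "mat2 a b c d = mat2 a' b' c' d' \<longleftrightarrow> a = a' \<and> b = b' \<and> c = c' \<and> d = d'"
  by (auto simp: mat2_def vec_eq_iff forall_2)

lemma mat2_arith:
  fixes a b c d a' b' c' d' k :: "'a::comm_ring_1"
  shows "mat2 a b c d ** mat2 a' b' c' d' =
           mat2 (a * a' + b * c') (a * b' + b * d') (c * a' + d * c') (c * b' + d * d')"
    and "mat2 a b c d + mat2 a' b' c' d' = mat2 (a + a') (b + b') (c + c') (d + d')"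
    and "- mat2 a b c d = mat2 (- a) (- b) (- c) (- d)"
    and "(mat k :: 'a ^ 2 ^ 2) = mat2 k 0 0 k"
  by (simp_all add: mat2_def vec_eq_iff forall_2 matrix_matrix_mult_def sum_2 mat_def)

lemma det_trace_mat2:
  fixes a b c d :: "'a::comm_ring_1"
  shows "det (mat2 a b c d) = a * d - b * c" and "trace (mat2 a b c d) = a + d"
  by (simp_all add: mat2_def det_2 trace_def sum_2)

lemmas mat2_simps = mat2_arith det_trace_mat2 mat2_eq_iff

lemma SL_sel [simp]:
  "carrier SL = {A. det A = 1}" "mult SL = (**)" "\<one>\<^bsub>SL\<^esub> = mat 1"
  by (simp_all add: SL_def)

interpretation SL: group "SL :: ('a::field ^ 'n ^ 'n) monoid"
  by (rule group_SL)

text \<open>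
  By the Cayley-Hamilton theorem, \<open>A\<^sup>2 = 1\<close> gives \<open>(trace A) A = 2\<close>, so \<open>A\<close> is a scalar matrix.
  Over a field of odd characteristic, this makes it possible to halve exponents modulo the centre.
\<close>

lemma square_eq_one_SL2:
  fixes A :: "'a::field ^ 2 ^ 2"
  assumes "(2::'a) \<noteq> 0" "det A = 1" "A ** A = mat 1"
  shows "A = mat 1 \<or> A = - mat 1"
proof -
  obtain a b c d where A: "A = mat2 a b c d" by (rule mat2_exhaust)
  have e: "a * d - b * c = 1" "a * a + b * c = 1" "a * b + b * d = 0" "c * a + d * c = 0"
      "c * b + d * d = 1"
    using assms(2,3) by (simp_all add: A mat2_simps)
  have "(a + d) * a = (a * a + b * c) + (a * d - b * c)"
      "(a + d) * (a - d) = (a * a + b * c) - (c * b + d * d)"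
      "(a + d) * b = a * b + b * d" "(a + d) * c = c * a + d * c"
    by (simp_all add: algebra_simps)
  then have "(a + d) * a = 2" "(a + d) * (a - d) = 0" "(a + d) * b = 0" "(a + d) * c = 0"
    unfolding e by simp_all
  moreover from this(1) have "a + d \<noteq> 0"
    using assms(1) by (metis mult_zero_left)
  ultimately have "a = d" "b = 0" "c = 0" by auto
  then show ?thesis
    using e \<open>a = d\<close> by (auto simp: A mat2_simps square_eq_1_iff)
qed

lemma mat2_scalar:
  fixes A :: "'a::comm_ring_1 ^ 2 ^ 2"
  shows "A ** mat k = mat k ** A" "trace (mat k ** A) = k * trace A"
    "det (mat k ** A) = k\<^sup>2 * det A" "mat k ** mat l = (mat (k * l) :: 'a ^ 2 ^ 2)"
    "- (mat k :: 'a ^ 2 ^ 2) = mat (- k)"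
    "trace (mat k :: 'a ^ 2 ^ 2) = 2 * k" "det (mat k :: 'a ^ 2 ^ 2) = k\<^sup>2"
  by (cases A rule: mat2_exhaust; simp add: mat2_simps algebra_simps power2_eq_square)+

lemma square_traceless:
  fixes A :: "'a::comm_ring_1 ^ 2 ^ 2"
  assumes "trace A = 0"
  shows "A ** A = mat (- det A)"
proof -
  obtain a b c d where A: "A = mat2 a b c d" by (rule mat2_exhaust)
  have "d = - a" using assms by (simp add: A mat2_simps eq_neg_iff_add_eq_0 add.commute)
  then show ?thesis by (simp add: A mat2_simps algebra_simps)
qed

text \<open>
  By the Cayley-Hamilton theorem, \<open>(trace T) T = T\<^sup>2 + 1 = 0\<close>.
\<close>

lemma trace_zero_if_square_minus_one:
  fixes T :: "'a::field ^ 2 ^ 2"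
  assumes "det T = 1" "T ** T = - mat 1"
  shows "trace T = 0"
proof -
  obtain a b c d where T: "T = mat2 a b c d" by (rule mat2_exhaust)
  have e: "a * d - b * c = 1" "a * a + b * c = - 1" "a * b + b * d = 0" "c * a + d * c = 0"
      "c * b + d * d = - 1"
    using assms by (simp_all add: T mat2_simps)
  have "(a + d) * a = (a * a + b * c) + (a * d - b * c)"
      "(a + d) * b = a * b + b * d"
    by (simp_all add: algebra_simps)
  then have "(a + d) * a = 0" "(a + d) * b = 0" unfolding e by simp_all
  then show ?thesis using e(1) by (auto simp: T mat2_simps)
qed

text \<open>
  Polarizing the Cayley-Hamilton identity gives
  \<open>T W + W T = (trace T) W + (trace W) T + trace (T W) - (trace T) (trace W)\<close>.
\<close>

lemma anticommute_if_traces_zero: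
  fixes T W :: "'a::comm_ring_1 ^ 2 ^ 2"
  assumes "trace T = 0" "trace W = 0" "trace (T ** W) = 0"
  shows "W ** T = - (T ** W)"
proof -
  obtain a b c d where W: "W = mat2 a b c d" by (rule mat2_exhaust)
  obtain k l m n where T: "T = mat2 k l m n" by (rule mat2_exhaust)
  have d: "d = - a" "n = - k"
    using assms(1,2) by (simp_all add: W T mat2_simps eq_neg_iff_add_eq_0 add.commute)
  have "2 * (k * a) + l * c + m * b = 0"
    using assms(3) by (simp add: W T d mat2_simps algebra_simps flip: mult_2)
  then have "l * c = - (2 * (k * a) + m * b)"
    by (simp add: eq_neg_iff_add_eq_0 algebra_simps)
  then show ?thesis
    by (simp add: W T d mat2_simps algebra_simps)
qed

text \<open>
  Here \<open>T\<^sup>2 = -1\<close>, so the matrices \<open>p + q T\<close> multiply like complex numbers with \<open>T\<close> as the imaginary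
  unit, and their determinant is the norm form \<open>p\<^sup>2 + q\<^sup>2\<close>.
\<close>

lemma mat_add_multiple:
  fixes T W :: "'a::comm_ring_1 ^ 2 ^ 2"
  assumes "trace T = 0" "det T = 1"
  shows "det (mat p + mat q ** T) = p\<^sup>2 + q\<^sup>2"
    and "(mat p + mat q ** T) ** T = T ** (mat p + mat q ** T)"
    and "trace ((mat p + mat q ** T) ** W) = p * trace W + q * trace (T ** W)"
    and "det (W + mat p + mat q ** T) =
           det W + p\<^sup>2 + q\<^sup>2 + p * trace W - q * trace (T ** W)"
    and "(mat p + mat q ** T) ** (mat p' + mat q' ** T) =
           mat (p * p' - q * q') + mat (p * q' + q * p') ** T"
proof -
  obtain a b c d where W: "W = mat2 a b c d" by (rule mat2_exhaust)
  obtain k l m n where T: "T = mat2 k l m n" by (rule mat2_exhaust)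
  have n: "n = - k"
    using assms(1) by (simp add: T mat2_simps eq_neg_iff_add_eq_0 add.commute)
  have "l * m = - (k * (- k) - l * m) - k * k" by simp
  also have "k * (- k) - l * m = 1" using assms(2) by (simp add: T n mat2_simps)
  finally have lm: "l * m = - 1 - k * k" .
  show "(mat p + mat q ** T) ** T = T ** (mat p + mat q ** T)"
    "trace ((mat p + mat q ** T) ** W) = p * trace W + q * trace (T ** W)"
    by (simp_all add: W T n mat2_simps algebra_simps)
  have "det (mat p + mat q ** T) = p\<^sup>2 + q\<^sup>2 * (- k * k - l * m)"
    by (simp add: T n mat2_simps algebra_simps power2_eq_square)
  then show "det (mat p + mat q ** T) = p\<^sup>2 + q\<^sup>2" by (simp add: lm)
  have "det (W + mat p + mat q ** T) =
           det W + p\<^sup>2 + q\<^sup>2 * (- k * k - l * m) + p * trace W - q * trace (T ** W)"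
    by (simp add: W T n mat2_simps algebra_simps power2_eq_square)
  then show "det (W + mat p + mat q ** T) =
           det W + p\<^sup>2 + q\<^sup>2 + p * trace W - q * trace (T ** W)" by (simp add: lm)
  show "(mat p + mat q ** T) ** (mat p' + mat q' ** T) =
           mat (p * p' - q * q') + mat (p * q' + q * p') ** T"
  proof -
    have "q * k * (q' * k) + q * l * (q' * m) = q * q' * (k * k + l * m)"
      by (simp add: algebra_simps)
    also have "\<dots> = - (q * q')" by (simp add: lm)
    finally show ?thesis
      by (simp add: T n mat2_simps algebra_simps)
  qed
qed

section \<open>Finite fields\<close>

lemma finite_field_power:
  fixes x :: "'a::{field,finite}"
  shows "x \<noteq> 0 \<Longrightarrow> x ^ (CARD('a) - 1) = 1" and "x ^ CARD('a) = x"
proof -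
  show *: "x ^ (CARD('a) - 1) = 1" if "x \<noteq> 0" for x :: 'a
  proof -
    have "(\<Prod>y\<in>UNIV-{0}. x * y) = \<Prod>(UNIV-{0})"
      by (rule prod.reindex_bij_witness[of _ "\<lambda>y. y / x" "\<lambda>y. x * y"]) (use that in auto)
    moreover have "(\<Prod>y\<in>UNIV-{0}. x * y) = x ^ (CARD('a) - 1) * \<Prod>(UNIV-{0})"
      by (simp add: prod.distrib)
    ultimately show ?thesis by (simp add: prod_zero_iff)
  qed
  have "x ^ CARD('a) = x ^ (CARD('a) - 1) * x"
    by (metis power_minus_mult zero_less_card_finite)
  then show "x ^ CARD('a) = x"
    using * by (cases "x = 0") auto
qed

lemma CARD_eq_CHAR_power:
  assumes "primepow CARD('a::{field,finite})"
  shows "Factorial_Ring.prime CHAR('a)" "\<exists>k. CARD('a) = CHAR('a) ^ k"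
proof -
  show pr: "Factorial_Ring.prime CHAR('a)"
    by (simp add: prime_CHAR_semidom finite_imp_CHAR_pos)
  obtain p k where pk: "Factorial_Ring.prime p" "CARD('a) = p ^ k"
    using assms by (auto simp: primepow_def)
  have "CHAR('a) dvd p ^ k"
    using CHAR_dvd_CARD[where ?'a = 'a] pk by simp
  then have "CHAR('a) = p"
    using pr pk by (metis prime_dvd_power primes_dvd_imp_eq)
  then show "\<exists>k. CARD('a) = CHAR('a) ^ k" using pk by blast
qed

text \<open>
  The number of elements is a power of the characteristic, and the characteristic is prime.
\<close>

lemma two_eq_zero_iff_even_CARD:
  assumes "primepow CARD('a::{field,finite})"
  shows "(2::'a) = 0 \<longleftrightarrow> even CARD('a)"
proof -
  obtain k where k: "CARD('a) = CHAR('a) ^ k" using CARD_eq_CHAR_power(2)[OF assms] by blast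
  have pr: "Factorial_Ring.prime CHAR('a)" by (rule CARD_eq_CHAR_power(1)[OF assms])
  have "(2::'a) = 0 \<longleftrightarrow> CHAR('a) dvd 2"
    using of_nat_eq_0_iff_char_dvd[of 2, where ?'a = 'a] by simp
  also have "\<dots> \<longleftrightarrow> even CHAR('a)"
    using pr by (metis primes_dvd_imp_eq two_is_prime_nat dvd_refl)
  also have "\<dots> \<longleftrightarrow> even CARD('a)"
  proof -
    have "CARD('a) \<noteq> 1" using primepow_gt_Suc_0[OF assms] by simp
    then show ?thesis unfolding k by (cases k) auto
  qed
  finally show ?thesis .
qed

lemma poly_frobenius:
  fixes f g :: "'a::{field,finite} poly"
  assumes "primepow CARD('a)"
  shows "(f + g) ^ CARD('a) = f ^ CARD('a) + g ^ CARD('a)"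
  using CARD_eq_CHAR_power[OF assms]
  by (metis freshmans_dream' semiring_char_poly)

lemma four_neq_zero:
  assumes "(2::'a::field) \<noteq> 0"
  shows "(4::'a) \<noteq> 0"
  using assms mult_eq_0_iff[of "2::'a" 2] by simp

lemma card_image_two_to_one:
  assumes "finite D" "\<And>x. x \<in> D \<Longrightarrow> card {y \<in> D. f y = f x} = 2"
  shows "card D = 2 * card (f ` D)"
proof -
  have "card D = (\<Sum>z\<in>f ` D. card {y \<in> D. f y = z})"
    using sum.image_gen[OF assms(1), of "\<lambda>_. 1::nat" f] by simp
  also have "\<dots> = (\<Sum>z\<in>f ` D. 2)"
    by (rule sum.cong) (use assms(2) in auto)
  finally show ?thesis by simp
qed

text \<open>
  The equation \<open>t\<^sup>2 - e = r\<^sup>2\<close> means \<open>(t + r) (t - r) = e\<close>, so its solutions are parametrized by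
  \<open>u = t + r\<close> with \<open>t = (u + e / u) / 2\<close>. Each \<open>t\<close> comes from exactly the two parameters \<open>u\<close> and
  \<open>e / u\<close>, and these are distinct because \<open>r \<noteq> 0\<close>.
\<close>

lemma card_square_minus:
  fixes e :: "'a::{field,finite}"
  assumes two: "(2::'a) \<noteq> 0" and e: "e \<noteq> 0"
  shows "2 * card {t. \<exists>r. r \<noteq> 0 \<and> t\<^sup>2 - e = r\<^sup>2} + card {u. u\<^sup>2 = e} + 1 = CARD('a)"
proof -
  define D where "D = {u. u \<noteq> 0 \<and> u\<^sup>2 \<noteq> e}"
  define f where "f u = (u + e / u) / 2" for u
  have fibre: "{y \<in> D. f y = f x} = {x, e / x}" and ne: "x \<noteq> e / x" if "x \<in> D" for x
  proof -
    have x: "x \<noteq> 0" "x\<^sup>2 \<noteq> e" using that by (auto simp: D_def)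
    show "x \<noteq> e / x" using x by (auto simp: power2_eq_square field_simps)
    have "f y = f x \<longleftrightarrow> y = x \<or> y = e / x" if "y \<noteq> 0" for y
    proof -
      have "f y = f x \<longleftrightarrow> y + e / y - (x + e / x) = 0"
        using two unfolding f_def divide_cancel_right by simp
      also have "y + e / y - (x + e / x) = (y - x) * (y * x - e) / (x * y)"
        using x that by (simp add: field_simps)
      also have "\<dots> = 0 \<longleftrightarrow> y = x \<or> y = e / x"
        using x that by (simp add: eq_divide_eq)
      finally show ?thesis .
    qed
    moreover have "e / x \<in> D"
      using x e by (auto simp: D_def power2_eq_square field_simps)
    ultimately show "{y \<in> D. f y = f x} = {x, e / x}"
      using \<open>x \<in> D\<close> by (auto simp: D_def)
  qed
  have "f ` D = {t. \<exists>r. r \<noteq> 0 \<and> t\<^sup>2 - e = r\<^sup>2}"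
  proof (intro subset_antisym subsetI)
    fix t assume "t \<in> f ` D"
    then obtain u where u: "u \<noteq> 0" "u\<^sup>2 \<noteq> e" "t = (u + e / u) / 2"
      by (auto simp: D_def f_def)
    define v where "v = e / u"
    have uv: "u * v = e" "2 * t = u + v" using u two by (simp_all add: v_def mult.commute)
    have "t\<^sup>2 - u * v = (t - v)\<^sup>2 + v * (2 * t - (u + v))"
      by (simp add: power2_eq_square algebra_simps)
    then have "t\<^sup>2 - e = (t - v)\<^sup>2" unfolding uv by simp
    moreover have "2 * (t - v) = u - v" using uv by (simp add: algebra_simps)
    moreover have "u \<noteq> v" using u(1,2) by (auto simp: v_def power2_eq_square field_simps)
    then have "u - v \<noteq> 0" by simp
    ultimately have "t\<^sup>2 - e = (t - v)\<^sup>2" "t - v \<noteq> 0" by auto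
    then show "t \<in> {t. \<exists>r. r \<noteq> 0 \<and> t\<^sup>2 - e = r\<^sup>2}" by blast
  next
    fix t assume "t \<in> {t. \<exists>r. r \<noteq> 0 \<and> t\<^sup>2 - e = r\<^sup>2}"
    then obtain r where r: "r \<noteq> 0" "t\<^sup>2 - e = r\<^sup>2" by blast
    define u v where "u = t + r" and "v = t - r"
    have "u * v = t\<^sup>2 - r\<^sup>2" by (simp add: u_def v_def power2_eq_square algebra_simps)
    also have "\<dots> = e" by (simp flip: r(2))
    finally have uv: "u * v = e" .
    have "u - v = 2 * r" by (simp add: u_def v_def)
    then have "u \<noteq> v" using r(1) two by auto
    then have "u \<noteq> 0" "v = e / u" "u\<^sup>2 \<noteq> e"
      using e uv by (auto simp: power2_eq_square field_simps)
    moreover have "t = (u + v) / 2"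
      using two by (simp add: u_def v_def flip: mult_2)
    ultimately show "t \<in> f ` D"
      by (auto simp: D_def f_def)
  qed
  moreover have "card D = 2 * card (f ` D)"
    by (rule card_image_two_to_one) (use ne in \<open>simp_all add: fibre\<close>)
  moreover have "card D + card {u. u\<^sup>2 = e} + 1 = CARD('a)"
  proof -
    have "(UNIV :: 'a set) = insert 0 (D \<union> {u. u\<^sup>2 = e})" by (auto simp: D_def)
    also have "card \<dots> = Suc (card (D \<union> {u. u\<^sup>2 = e}))"
      using e by (subst card_insert_disjoint) (auto simp: D_def)
    also have "card (D \<union> {u. u\<^sup>2 = e}) = card D + card {u. u\<^sup>2 = e}"
      by (rule card_Un_disjoint) (auto simp: D_def)
    finally show ?thesis by simp
  qed
  ultimately show ?thesis by simp
qed

lemma card_square_minus_4: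
  assumes two: "(2::'a::{field,finite}) \<noteq> 0"
  shows "2 * card {t :: 'a. \<exists>r. r \<noteq> 0 \<and> t\<^sup>2 - 4 = r\<^sup>2} + 3 = CARD('a)"
proof -
  have "{u :: 'a. u\<^sup>2 = 4} = {2, - 2}"
    using power2_eq_iff[of _ "2::'a"] by auto
  moreover have "(2::'a) \<noteq> - 2"
    using four_neq_zero[OF two] by (simp add: eq_neg_iff_add_eq_0)
  ultimately show ?thesis
    using card_square_minus[OF two four_neq_zero[OF two]] by simp
qed

text \<open>
  Squaring is two-to-one on the nonzero elements, so there are \<open>m\<close> nonzero squares. They are roots
  of \<open>X ^ m - 1\<close>, which has at most \<open>m\<close> roots.
\<close>

lemma Euler_criterion_finite_field:
  fixes x :: "'a::{field,finite}"
  assumes two: "(2::'a) \<noteq> 0" and q: "CARD('a) = 2 * m + 1" and x: "x \<noteq> 0"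
  shows "(\<exists>y. x = y\<^sup>2) \<longleftrightarrow> x ^ m = 1"
proof -
  define S where "S = power2 ` (UNIV - {0 :: 'a})"
  have pow: "y ^ (2 * m) = 1" if "y \<noteq> 0" for y :: 'a
    using finite_field_power(1)[OF that] q by simp
  have m0: "m > 0"
    using q card_mono[of "UNIV :: 'a set" "{0, 1}"] by simp
  have "{y \<in> UNIV - {0}. y\<^sup>2 = z\<^sup>2} = {z, - z}" "z \<noteq> - z" if "z \<in> UNIV - {0}" for z :: 'a
    using that two by (auto simp: power2_eq_iff eq_neg_iff_add_eq_0 simp flip: mult_2)
  then have "card (UNIV - {0 :: 'a}) = 2 * card S"
    unfolding S_def by (intro card_image_two_to_one) simp_all
  then have "card S = m" using q by (simp add: card_Diff_singleton)
  define P where "P = [:0, 1:] ^ m - [:1 :: 'a:]"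
  have "Polynomial.degree P = m"
    unfolding P_def diff_conv_add_uminus using m0 degree_add_eq_left[of "- [:1::'a:]" "[:0, 1:] ^ m"]
    by (simp add: degree_power_eq)
  then have "card {z. poly P z = 0} \<le> m"
    using card_poly_roots_bound[of P] m0 by fastforce
  moreover have roots: "{z. poly P z = 0} = {z. z ^ m = 1}" by (simp add: P_def)
  moreover have "S \<subseteq> {z. z ^ m = 1}"
    using pow by (auto simp: S_def simp flip: power_mult)
  ultimately have "S = {z. z ^ m = 1}"
    using \<open>card S = m\<close> by (intro card_seteq) auto
  then have "x ^ m = 1 \<longleftrightarrow> x \<in> S" by simp
  also have "\<dots> \<longleftrightarrow> (\<exists>y. x = y\<^sup>2)" using x by (auto simp: S_def)
  finally show ?thesis by simp
qed

lemma minus_one_square: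
  assumes "(2::'a::{field,finite}) \<noteq> 0" and "CARD('a) mod 4 = 1"
  obtains i :: "'a::{field,finite}" where "i\<^sup>2 = - 1"
proof -
  define m where "m = (CARD('a) - 1) div 2"
  have m: "CARD('a) = 2 * m + 1" "even m" using assms(2) unfolding m_def by presburger+
  then show ?thesis
    using Euler_criterion_finite_field[OF assms(1) m(1), of "- 1"] that by fastforce
qed

lemma square_or_minus_square:
  fixes x :: "'a::{field,finite}"
  assumes two: "(2::'a) \<noteq> 0" and q: "CARD('a) mod 4 = 3"
  shows "\<exists>y. x = y\<^sup>2 \<or> - x = y\<^sup>2"
proof (cases "x = 0")
  case False
  define m where "m = (CARD('a) - 1) div 2"
  have m: "CARD('a) = 2 * m + 1" "odd m" using q unfolding m_def by presburger+
  have "(x ^ m)\<^sup>2 = x ^ (CARD('a) - 1)" by (simp add: m(1) mult.commute flip: power_mult)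
  also have "\<dots> = 1" using False by (rule finite_field_power(1))
  finally have "x ^ m = 1 \<or> (- x) ^ m = 1"
    using m(2) by (auto simp: power2_eq_1_iff)
  then show ?thesis
    using Euler_criterion_finite_field[OF two m(1)] False by (metis neg_equal_0_iff_equal)
qed (auto intro: exI[of _ 0])

text \<open>
  There are \<open>(q - 1) / 2\<close> elements \<open>t\<close> such that \<open>t\<^sup>2 - M\<close> is a nonzero square, but only
  \<open>(q - 3) / 2\<close> such that \<open>t\<^sup>2 - 4\<close> is. As \<open>-1\<close> is a square, \<open>t\<^sup>2 - M\<close> and \<open>M - t\<^sup>2\<close> are squares
  simultaneously. The hypothesis on \<open>M - 4\<close> excludes \<open>t\<^sup>2 = 4\<close>.
\<close>

lemma exists_elliptic_trace:
  fixes M :: "'a::{field,finite}"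
  assumes two: "(2::'a) \<noteq> 0" and q: "CARD('a) mod 4 = 1"
    and M: "\<And>s. M \<noteq> s\<^sup>2" "\<And>s. M - 4 \<noteq> s\<^sup>2"
  shows "\<exists>t s. t\<^sup>2 + s\<^sup>2 = M \<and> (\<forall>r. t\<^sup>2 - 4 \<noteq> r\<^sup>2)"
proof -
  obtain i :: 'a where i: "i\<^sup>2 = - 1" using minus_one_square[OF two q] .
  let ?S = "\<lambda>e. {t :: 'a. \<exists>r. r \<noteq> 0 \<and> t\<^sup>2 - e = r\<^sup>2}"
  have "M \<noteq> 0" using M(1)[of 0] by simp
  moreover have "{u. u\<^sup>2 = M} = {}" using M(1) by auto
  ultimately have "2 * card (?S M) + 1 = CARD('a)"
    using card_square_minus[OF two, of M] by simp
  moreover note card_square_minus_4[OF two]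
  ultimately have "\<not> card (?S M) \<le> card (?S 4)" by linarith
  then have "\<not> ?S M \<subseteq> ?S 4"
    using card_mono[of "?S 4" "?S M"] by auto
  then obtain t r where t: "t\<^sup>2 - M = r\<^sup>2" "t \<notin> ?S 4"
    by blast
  have "t\<^sup>2 + (i * r)\<^sup>2 = M"
    using t(1) i by (simp add: power_mult_distrib algebra_simps)
  moreover have "t\<^sup>2 - 4 \<noteq> r'\<^sup>2" for r'
  proof
    assume r': "t\<^sup>2 - 4 = r'\<^sup>2"
    then have "r' = 0" using t(2) by blast
    with r' have "t\<^sup>2 = 4" by simp
    then have "M - 4 = (i * r)\<^sup>2"
      using t(1) i by (simp add: power_mult_distrib algebra_simps)
    then show False using M(2) by blast
  qed
  ultimately show ?thesis by blast
qed

text \<open>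
  There are \<open>(q + 1) / 2\<close> elements \<open>t\<close> such that \<open>t\<^sup>2 - 4\<close> is a square, but at most \<open>(q - 1) / 2\<close>
  such that \<open>t\<^sup>2 - M\<close> is a nonzero square. As \<open>-1\<close> is not a square, \<open>M - t\<^sup>2\<close> is a square for all
  other \<open>t\<close>.
\<close>

lemma exists_hyperbolic_trace:
  fixes M :: "'a::{field,finite}"
  assumes two: "(2::'a) \<noteq> 0" and q: "CARD('a) mod 4 = 3" and M: "M \<noteq> 0"
  shows "\<exists>t s r. t\<^sup>2 + s\<^sup>2 = M \<and> t\<^sup>2 - 4 = r\<^sup>2"
proof -
  let ?S = "\<lambda>e. {t :: 'a. \<exists>r. r \<noteq> 0 \<and> t\<^sup>2 - e = r\<^sup>2}"
  have "2 * card (?S M) + 1 \<le> CARD('a)"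
    using card_square_minus[OF two M] by simp
  moreover have "2 * card (?S 4 \<union> {2, - 2}) = CARD('a) + 1"
  proof -
    have "(2::'a) \<noteq> - 2"
      using four_neq_zero[OF two] by (simp add: eq_neg_iff_add_eq_0)
    moreover note card_square_minus_4[OF two]
    moreover have "card (?S 4 \<union> {2, - 2}) = card (?S 4) + card {2::'a, - 2}"
      by (rule card_Un_disjoint) auto
    ultimately show ?thesis by simp
  qed
  ultimately have "\<not> card (?S 4 \<union> {2, - 2}) \<le> card (?S M)" by linarith
  then have "\<not> ?S 4 \<union> {2, - 2} \<subseteq> ?S M"
    using card_mono[of "?S M" "?S 4 \<union> {2, - 2}"] by auto
  then obtain t where t: "t \<in> ?S 4 \<union> {2, - 2}" "t \<notin> ?S M"
    by (meson subsetI)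
  have "\<exists>r. t\<^sup>2 - 4 = r\<^sup>2"
  proof (cases "t \<in> ?S 4")
    case True
    then show ?thesis by blast
  next
    case False
    then have "t = 2 \<or> t = - 2" using t(1) by (simp only: Un_iff insert_iff empty_iff simp_thms)
    then have "t\<^sup>2 - 4 = 0\<^sup>2" by auto
    then show ?thesis by blast
  qed
  moreover have "\<exists>s. t\<^sup>2 + s\<^sup>2 = M"
  proof -
    obtain y where "t\<^sup>2 - M = y\<^sup>2 \<or> - (t\<^sup>2 - M) = y\<^sup>2"
      using square_or_minus_square[OF two q] by blast
    moreover have "y = 0" if "t\<^sup>2 - M = y\<^sup>2" using t(2) that by blast
    ultimately show ?thesis by (intro exI[of _ y]) (auto simp: algebra_simps)
  qed
  ultimately show ?thesis by blast
qed

section \<open>Orders of elements of SL(2,q) from their traces\<close>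

text \<open>
  The powers of \<open>A\<close> and the powers of the indeterminate modulo the characteristic polynomial
  satisfy the same recursion, so they have the same coordinates. This transfers congruences
  between polynomials to identities between matrices without evaluating polynomials at matrices.
\<close>

lemma SL2_pow_linear:
  fixes A :: "'a::field ^ 2 ^ 2"
  assumes "det A = 1"
  shows "\<exists>a b. A [^]\<^bsub>SL\<^esub> (n::nat) = mat a ** A + mat b \<and>
           [:1, - trace A, 1:] dvd [:0, 1:] ^ n - [:b, a:]"
proof (induction n)
  case 0
  have "mat 1 = mat 0 ** A + mat 1"
    by (cases A rule: mat2_exhaust) (simp add: mat2_simps)
  then show ?case
    by (intro exI[of _ 0] exI[of _ 1]) (simp add: one_pCons)
next
  case (Suc n)
  then obtain a b where IH: "A [^]\<^bsub>SL\<^esub> n = mat a ** A + mat b"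
      "[:1, - trace A, 1:] dvd [:0, 1:] ^ n - [:b, a:]"
    by blast
  have "A [^]\<^bsub>SL\<^esub> Suc n = (mat a ** A + mat b) ** A"
    by (simp add: IH)
  also have "\<dots> = mat (a * trace A + b) ** A + mat (- a)"
  proof -
    obtain p q r s where A: "A = mat2 p q r s" by (rule mat2_exhaust)
    have "p * s - q * r = 1" using assms by (simp add: A mat2_simps)
    moreover have "(a * p + b) * p + a * q * r = (a * (p + s) + b) * p - a * (p * s - q * r)"
        "(a * p + b) * q + a * q * s = (a * (p + s) + b) * q"
        "a * r * p + (a * s + b) * r = (a * (p + s) + b) * r"
        "a * r * q + (a * s + b) * s = (a * (p + s) + b) * s - a * (p * s - q * r)"
      by (simp_all add: algebra_simps)
    ultimately show ?thesis
      by (simp add: A mat2_simps)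
  qed
  finally have 1: "A [^]\<^bsub>SL\<^esub> Suc n = mat (a * trace A + b) ** A + mat (- a)" .
  have "[:1, - trace A, 1:] dvd [:0, 1:] * ([:0, 1:] ^ n - [:b, a:]) + [:a:] * [:1, - trace A, 1:]"
    using IH(2) by (intro dvd_add dvd_mult dvd_refl)
  also have "\<dots> = [:0, 1:] ^ Suc n - [:- a, a * trace A + b:]"
    by (simp add: algebra_simps)
  finally show ?case using 1 by blast
qed

lemma SL2_pow_eq_scalar:
  fixes A :: "'a::field ^ 2 ^ 2"
  assumes "det A = 1" and dvd: "[:1, - trace A, 1:] dvd [:0, 1:] ^ n - [:c:]"
  shows "A [^]\<^bsub>SL\<^esub> n = mat c"
proof -
  let ?P = "[:1, - trace A, 1:]"
  obtain a b where ab: "A [^]\<^bsub>SL\<^esub> n = mat a ** A + mat b" "?P dvd [:0, 1:] ^ n - [:b, a:]"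
    using SL2_pow_linear[OF assms(1)] by blast
  have "?P dvd ([:0, 1:] ^ n - [:c:]) - ([:0, 1:] ^ n - [:b, a:])"
    using dvd ab(2) by (rule dvd_diff)
  also have "\<dots> = [:b - c, a:]" by simp
  finally have "?P dvd [:b - c, a:]" .
  moreover have "\<not> Polynomial.degree ?P \<le> Polynomial.degree [:b - c, a:]"
    by (simp add: degree_pCons_eq_if)
  ultimately have "[:b - c, a:] = 0"
    by (meson dvd_imp_degree_le)
  then have "a = 0" "b = c" by (simp_all add: pCons_eq_0_iff)
  with ab(1) show ?thesis
    by (cases A rule: mat2_exhaust) (simp add: mat2_simps)
qed

text \<open>
  The polynomial \<open>X ^ (q - 1) - 1\<close> vanishes at both roots of the characteristic polynomial.
\<close>

lemma SL2_pow_split: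
  fixes A :: "'a::{field,finite} ^ 2 ^ 2"
  assumes "det A = 1" "trace A = u + v" "u * v = 1" "u \<noteq> v"
  shows "A [^]\<^bsub>SL\<^esub> (CARD('a) - 1) = mat 1"
proof (rule SL2_pow_eq_scalar[OF assms(1)])
  let ?f = "[:0, 1:] ^ (CARD('a) - 1) - [:1:] :: 'a poly"
  have "u \<noteq> 0" "v \<noteq> 0" using assms by auto
  then have "poly ?f u = 0" "poly ?f v = 0"
    by (simp_all add: finite_field_power(1)[unfolded One_nat_def])
  then have d: "[:- u, 1:] dvd ?f" "[:- v, 1:] dvd ?f"
    by (simp_all only: poly_eq_0_iff_dvd)
  then obtain g where g: "?f = [:- u, 1:] * g" by auto
  have "poly g v = 0"
    using \<open>poly ?f v = 0\<close> assms(4) unfolding g by simp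
  then have "[:- v, 1:] dvd g" by (simp add: poly_eq_0_iff_dvd)
  then have "[:- u, 1:] * [:- v, 1:] dvd ?f"
    unfolding g by (rule mult_dvd_mono[OF dvd_refl])
  then show "[:1, - trace A, 1:] dvd ?f"
    using assms(2,3) by (simp add: algebra_simps)
qed

text \<open>
  The characteristic polynomial is \<open>(X - e)\<^sup>2\<close>, and it divides \<open>(X - e) ^ q = X ^ q - e\<close>.
\<close>

lemma SL2_pow_double:
  fixes A :: "'a::{field,finite} ^ 2 ^ 2"
  assumes pp: "primepow CARD('a)" and "det A = 1" "trace A = 2 * e" "e * e = 1"
  shows "A [^]\<^bsub>SL\<^esub> CARD('a) = mat e"
proof (rule SL2_pow_eq_scalar[OF assms(2)])
  have "[:- e, 1:] ^ CARD('a) = [:0, 1:] ^ CARD('a) + [:- e:] ^ CARD('a)"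
    using poly_frobenius[OF pp, of "[:0, 1:]" "[:- e:]"] by simp
  also have "\<dots> = [:0, 1:] ^ CARD('a) - [:e:]"
    by (simp add: poly_const_pow finite_field_power)
  finally have "[:- e, 1:] ^ CARD('a) = [:0, 1:] ^ CARD('a) - [:e:]" .
  moreover have "[:- e, 1:] ^ 2 dvd [:- e, 1:] ^ CARD('a)"
    using pp by (intro le_imp_power_dvd) (metis primepow_gt_Suc_0 Suc_leI numeral_2_eq_2)
  moreover have "[:- e, 1:] ^ 2 = [:1, - trace A, 1:]"
    using assms by (simp add: power2_eq_square)
  ultimately show "[:1, - trace A, 1:] dvd [:0, 1:] ^ CARD('a) - [:e:]" by simp
qed

text \<open>
  The ring of polynomials modulo the characteristic polynomial \<open>P\<close> is a field, in which \<open>P\<close> has the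
  roots \<open>X\<close> and \<open>trace A - X\<close>, with product 1. As \<open>X ^ q\<close> is also a root of \<open>P\<close>, it is one of these
  two. It is not \<open>X\<close>, since otherwise \<open>P\<close> would divide \<open>X ^ q - X\<close>, which vanishes on the whole
  field, and the quotient would have too many roots. So \<open>X ^ q\<close> is the inverse of \<open>X\<close>.
\<close>

lemma SL2_pow_irreducible:
  fixes A :: "'a::{field,finite} ^ 2 ^ 2"
  assumes pp: "primepow CARD('a)" and "det A = 1"
    and no_root: "\<And>u. poly [:1, - trace A, 1:] u \<noteq> 0"
  shows "A [^]\<^bsub>SL\<^esub> (CARD('a) + 1) = mat 1"
proof (rule SL2_pow_eq_scalar[OF assms(2)])
  let ?q = "CARD('a)" and ?t = "trace A"
  let ?P = "[:1, - ?t, 1:]" and ?X = "[:0, 1:] :: 'a poly"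
  have q2: "?q \<ge> 2" using pp by (metis primepow_gt_Suc_0 Suc_leI numeral_2_eq_2)
  have "Factorial_Ring.irreducible ?P"
  proof (rule Factorial_Ring.irreducibleI)
    show "\<not> is_unit ?P" by (simp add: is_unit_iff_degree)
  next
    fix f g assume fg: "?P = f * g"
    then have nz: "f \<noteq> 0" "g \<noteq> 0" by auto
    have lin: "\<exists>u. poly h u = 0" if "Polynomial.degree h = 1" for h :: "'a poly"
    proof -
      obtain b k where k: "h = pCons b k" by (rule pCons_cases)
      with that have "k \<noteq> 0" "Polynomial.degree k = 0" by (auto split: if_splits)
      then obtain a where "h = [:b, a:]" "a \<noteq> 0"
        using k by (auto elim!: degree_eq_zeroE)
      then show ?thesis by (intro exI[of _ "- b / a"]) simp
    qed
    have "Polynomial.degree f + Polynomial.degree g = 2"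
      using arg_cong[OF fg, of Polynomial.degree] nz by (simp add: degree_mult_eq)
    moreover have "Polynomial.degree f \<noteq> 1" "Polynomial.degree g \<noteq> 1"
      using lin no_root unfolding fg by auto
    ultimately have "Polynomial.degree f = 0 \<or> Polynomial.degree g = 0" by linarith
    then show "is_unit f \<or> is_unit g"
      using nz by (simp add: is_unit_iff_degree)
  qed simp
  then have prime: "Factorial_Ring.prime_elem ?P" by (rule field_poly_irreducible_imp_prime)
  have frob: "?P ^ ?q = 1 + [:- ?t:] * ?X ^ ?q + (?X ^ 2) ^ ?q"
  proof -
    have "?P = (1 + [:- ?t:] * ?X) + ?X ^ 2" by (simp add: power2_eq_square one_pCons)
    then have "?P ^ ?q = (1 + [:- ?t:] * ?X) ^ ?q + (?X ^ 2) ^ ?q"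
      by (subst \<open>?P = _\<close>) (rule poly_frobenius[OF pp])
    also have "(1 + [:- ?t:] * ?X) ^ ?q = 1 + ([:- ?t:] * ?X) ^ ?q"
      by (simp only: poly_frobenius[OF pp] power_one)
    also have "([:- ?t:] * ?X) ^ ?q = [:- ?t:] * ?X ^ ?q"
      by (simp only: power_mult_distrib poly_const_pow finite_field_power)
    finally show ?thesis .
  qed
  have "(?X ^ ?q - ?X) * (?X ^ ?q + ?X - [:?t:]) = ?P ^ ?q - ?P"
  proof -
    have "(Y - Z) * (Y + Z - T) = (1 + (- T) * Y + Y ^ 2) - (1 + (- T) * Z + Z ^ 2)"
      for Y Z T :: "'a poly"
      by (simp add: algebra_simps power2_eq_square)
    moreover have "?P = 1 + (- [:?t:]) * ?X + ?X ^ 2" "[:- ?t:] = - [:?t:]"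
      by (simp_all add: power2_eq_square one_pCons)
    moreover have "(?X ^ 2) ^ ?q = (?X ^ ?q) ^ 2"
      by (simp only: power_mult[symmetric] mult.commute)
    ultimately show ?thesis
      unfolding frob by metis
  qed
  moreover have "?P dvd ?P ^ ?q - ?P"
    using q2 by (intro dvd_diff dvd_power dvd_refl) auto
  ultimately have "?P dvd (?X ^ ?q - ?X) * (?X ^ ?q + ?X - [:?t:])"
    by simp
  then consider "?P dvd ?X ^ ?q - ?X" | "?P dvd ?X ^ ?q + ?X - [:?t:]"
    using prime by (auto simp: prime_elem_dvd_mult_iff)
  then show "?P dvd ?X ^ (?q + 1) - [:1:]"
  proof cases
    case 1
    then obtain g where g: "?X ^ ?q - ?X = ?P * g" by (rule dvdE)
    have deg: "Polynomial.degree (?X ^ ?q - ?X) = ?q"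
      unfolding diff_conv_add_uminus
      using q2 degree_add_eq_left[of "- ?X" "?X ^ ?q"] by (simp add: degree_power_eq)
    then have nz: "g \<noteq> 0" using g q2 by (metis degree_0 mult_zero_right not_numeral_le_zero)
    have "Polynomial.degree g + 2 = ?q"
    proof -
      have "Polynomial.degree (?P * g) = Polynomial.degree ?P + Polynomial.degree g"
        using nz by (intro degree_mult_eq) auto
      then show ?thesis using deg unfolding g by simp
    qed
    moreover have "poly g u = 0" for u
    proof -
      have "poly (?X ^ ?q - ?X) u = 0" by (simp add: finite_field_power)
      then show ?thesis
        using no_root[of u] unfolding g poly_mult mult_eq_0_iff by blast
    qed
    then have "card {u. poly g u = 0} = ?q" by simp
    ultimately show ?thesis
      using card_poly_roots_bound[OF nz] by simp
  next
    case 2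
    have "?X ^ (?q + 1) - [:1:] = ?X * (?X ^ ?q + ?X - [:?t:]) - ?P"
      by (simp add: algebra_simps)
    moreover have "?P dvd ?X * (?X ^ ?q + ?X - [:?t:]) - ?P"
      by (rule dvd_diff[OF dvd_mult[OF 2] dvd_refl])
    ultimately show ?thesis by (simp only:)
  qed
qed

text \<open>
  For determinant 1, this is equivalent to the class in \<open>PSL(2,q)\<close> having odd order.
\<close>

definition odd_order_mod_sign :: "'a::field ^ 2 ^ 2 \<Rightarrow> bool" where
  "odd_order_mod_sign A \<longleftrightarrow>
     (\<exists>m. odd m \<and> (A [^]\<^bsub>SL\<^esub> (m::nat) = mat 1 \<or> A [^]\<^bsub>SL\<^esub> m = - mat 1))"

lemma odd_order_mod_sign_half:
  fixes A :: "'a::field ^ 2 ^ 2" and m :: nat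
  assumes "(2::'a) \<noteq> 0" "det A = 1" "A [^]\<^bsub>SL\<^esub> (2 * m) = mat 1" "odd m"
  shows "odd_order_mod_sign A"
proof -
  have A: "A \<in> carrier SL" using assms by simp
  have "A [^]\<^bsub>SL\<^esub> m \<in> carrier SL" using A by (rule SL.nat_pow_closed)
  moreover have "A [^]\<^bsub>SL\<^esub> m ** A [^]\<^bsub>SL\<^esub> m = mat 1"
    using SL.nat_pow_mult[OF A, of m m] assms(3) by (simp add: mult_2)
  ultimately show ?thesis
    using square_eq_one_SL2[OF assms(1)] assms(4) unfolding odd_order_mod_sign_def by auto
qed

lemma odd_order_even_CARD:
  fixes A :: "'a::{field,finite} ^ 2 ^ 2"
  assumes pp: "primepow CARD('a)" and ev: "even CARD('a)" and A: "det A = 1" "trace A \<noteq> 0"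
  shows "odd_order_mod_sign A"
proof (cases "\<exists>u. poly [:1, - trace A, 1:] u = 0")
  case True
  then obtain u where "1 + u * (u - trace A) = 0"
    by (auto simp: algebra_simps)
  moreover have "u * (trace A - u) = 1 - (1 + u * (u - trace A))"
    by (simp add: algebra_simps)
  ultimately have u: "u * (trace A - u) = 1" by simp
  have two: "(2::'a) = 0" using two_eq_zero_iff_even_CARD[OF pp] ev by simp
  have "u \<noteq> trace A - u"
  proof
    assume "u = trace A - u"
    then have "trace A = 2 * u" by (simp add: algebra_simps)
    with two A(2) show False by simp
  qed
  then have "A [^]\<^bsub>SL\<^esub> (CARD('a) - 1) = mat 1"
    using SL2_pow_split[OF A(1) _ u] by simp
  moreover have "odd (CARD('a) - 1)" using ev by simp
  ultimately show ?thesis unfolding odd_order_mod_sign_def by blast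
next
  case False
  then have "A [^]\<^bsub>SL\<^esub> (CARD('a) + 1) = mat 1"
    using SL2_pow_irreducible[OF pp A(1)] by blast
  moreover have "odd (CARD('a) + 1)" using ev by simp
  ultimately show ?thesis unfolding odd_order_mod_sign_def by blast
qed

lemma odd_order_unipotent:
  fixes A :: "'a::{field,finite} ^ 2 ^ 2"
  assumes pp: "primepow CARD('a)" and od: "odd CARD('a)"
    and A: "det A = 1" "trace A = 2 \<or> trace A = - 2"
  shows "odd_order_mod_sign A"
proof -
  obtain e :: 'a where e: "trace A = 2 * e" "e = 1 \<or> e = - 1"
    using A(2) by (metis mult_1_right mult_minus1_right)
  have "A [^]\<^bsub>SL\<^esub> CARD('a) = mat e"
    using SL2_pow_double[OF pp A(1) e(1)] e(2) by auto
  moreover have "mat (- 1) = - (mat 1 :: 'a ^ 2 ^ 2)" by (simp add: mat2_simps)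
  ultimately show ?thesis
    using e(2) od unfolding odd_order_mod_sign_def by metis
qed

lemma odd_order_CARD_3_mod_4:
  fixes A :: "'a::{field,finite} ^ 2 ^ 2"
  assumes pp: "primepow CARD('a)" and q: "CARD('a) mod 4 = 3"
    and A: "det A = 1" "(trace A)\<^sup>2 - 4 = r\<^sup>2"
  shows "odd_order_mod_sign A"
proof (cases "r = 0")
  case True
  then have "(trace A - 2) * (trace A + 2) = 0"
    using A(2) by (simp add: algebra_simps power2_eq_square)
  then have "trace A = 2 \<or> trace A = - 2"
    by (simp add: eq_neg_iff_add_eq_0)
  moreover have "odd CARD('a)" using q by presburger
  ultimately show ?thesis using odd_order_unipotent[OF pp _ A(1)] by blast
next
  case False
  have "odd CARD('a)" using q by presburger
  then have two: "(2::'a) \<noteq> 0" using two_eq_zero_iff_even_CARD[OF pp] by simp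
  define u v where "u = (trace A + r) / 2" and "v = (trace A - r) / 2"
  have uv: "2 * u = trace A + r" "2 * v = trace A - r"
    unfolding u_def v_def using two by simp_all
  then have "2 * (u + v) = 2 * trace A" "2 * (u - v) = 2 * r"
    by (simp_all add: algebra_simps)
  then have "u + v = trace A" "u - v = r"
    using two by (metis mult_cancel_left)+
  moreover have "u * v = 1"
  proof -
    have "4 * (u * v) = (2 * u) * (2 * v)" by simp
    also have "\<dots> = (trace A)\<^sup>2 - r\<^sup>2"
      unfolding uv by (simp add: algebra_simps power2_eq_square)
    also have "\<dots> = 4" by (simp flip: A(2))
    finally show ?thesis using four_neq_zero[OF two] by simp
  qed
  ultimately have "A [^]\<^bsub>SL\<^esub> (CARD('a) - 1) = mat 1"
    using SL2_pow_split[OF A(1), of u v] False by auto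
  moreover have "CARD('a) - 1 = 2 * ((CARD('a) - 1) div 2)" "odd ((CARD('a) - 1) div 2)"
    using q by presburger+
  ultimately show ?thesis
    using odd_order_mod_sign_half[OF two A(1)] by metis
qed

lemma odd_order_CARD_1_mod_4:
  fixes A :: "'a::{field,finite} ^ 2 ^ 2"
  assumes pp: "primepow CARD('a)" and q: "CARD('a) mod 4 = 1"
    and A: "det A = 1" "\<And>r. (trace A)\<^sup>2 - 4 \<noteq> r\<^sup>2"
  shows "odd_order_mod_sign A"
proof -
  have "odd CARD('a)" using q by presburger
  then have two: "(2::'a) \<noteq> 0" using two_eq_zero_iff_even_CARD[OF pp] by simp
  have "poly [:1, - trace A, 1:] u \<noteq> 0" for u
  proof
    assume "poly [:1, - trace A, 1:] u = 0"
    then have "1 + u * (u - trace A) = 0"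
      by (simp add: algebra_simps)
    moreover have "(2 * u - trace A)\<^sup>2 = (trace A)\<^sup>2 - 4 + 4 * (1 + u * (u - trace A))"
      by (simp add: algebra_simps power2_eq_square)
    ultimately have "(trace A)\<^sup>2 - 4 = (2 * u - trace A)\<^sup>2" by simp
    then show False using A(2) by blast
  qed
  then have "A [^]\<^bsub>SL\<^esub> (CARD('a) + 1) = mat 1"
    by (rule SL2_pow_irreducible[OF pp A(1)])
  moreover have "CARD('a) + 1 = 2 * ((CARD('a) + 1) div 2)" "odd ((CARD('a) + 1) div 2)"
    using q by presburger+
  ultimately show ?thesis
    using odd_order_mod_sign_half[OF two A(1)] by metis
qed

section \<open>Traces in a coset of the centralizer\<close>

text \<open>
  Identify \<open>p + q T\<close> with the complex number \<open>p + q i\<close>. The multiplier is then the quotient of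
  \<open>t + s i\<close> by \<open>trace W - trace (T W) i\<close>: both have norm \<open>M\<close>, so the quotient has norm 1.
  The trace of \<open>(p + q T) W\<close> is the real part of \<open>(p + q i) (trace W - trace (T W) i)\<close>.
\<close>

lemma commuting_multiple_with_trace:
  fixes T W :: "'a::field ^ 2 ^ 2"
  assumes T: "trace T = 0" "det T = 1"
    and M: "M = (trace W)\<^sup>2 + (trace (T ** W))\<^sup>2" "M \<noteq> 0" and ts: "t\<^sup>2 + s\<^sup>2 = M"
  shows "\<exists>C. det C = 1 \<and> C ** T = T ** C \<and> trace (C ** W) = t"
proof -
  define x y where "x = trace W" and "y = trace (T ** W)"
  have M': "M = x\<^sup>2 + y\<^sup>2" using M(1) by (simp add: x_def y_def)
  define p q where "p = (t * x - s * y) / M" and "q = (t * y + s * x) / M"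
  have "p\<^sup>2 + q\<^sup>2 = ((t * x - s * y)\<^sup>2 + (t * y + s * x)\<^sup>2) / M\<^sup>2"
    by (simp add: p_def q_def power_divide flip: add_divide_distrib)
  also have "(t * x - s * y)\<^sup>2 + (t * y + s * x)\<^sup>2 = (t\<^sup>2 + s\<^sup>2) * (x\<^sup>2 + y\<^sup>2)"
    by (simp add: power2_eq_square algebra_simps)
  also have "\<dots> / M\<^sup>2 = 1"
    using M(2) unfolding ts M'[symmetric] by (simp add: power2_eq_square)
  finally have "p\<^sup>2 + q\<^sup>2 = 1" .
  moreover have "p * x + q * y = ((t * x - s * y) * x + (t * y + s * x) * y) / M"
    by (simp add: p_def q_def flip: add_divide_distrib)
  then have "p * x + q * y = t * (x\<^sup>2 + y\<^sup>2) / M"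
    by (simp add: power2_eq_square algebra_simps)
  then have "p * x + q * y = t"
    using M(2) unfolding M'[symmetric] by simp
  ultimately show ?thesis
    using mat_add_multiple(1,2,3)[OF T] unfolding x_def y_def by metis
qed

text \<open>
  Write \<open>W = V + Y\<close>, where \<open>V\<close> is a combination of \<open>1\<close> and \<open>T\<close>, and \<open>Y\<close> anticommutes with \<open>T\<close>. Their
  determinants are \<open>M / 4\<close> and \<open>d = 1 - M / 4\<close>. If \<open>b\<^sup>2 = - M / 4\<close>, then \<open>U = 1 + b T\<close> also has determinant
  \<open>d\<close>, and the required matrix is \<open>U\<close> times the inverse \<open>- Y / d\<close> of \<open>Y\<close>. Its product with \<open>Y\<close> is
  \<open>U\<close>, of trace 2, and its product with \<open>V\<close> anticommutes with \<open>T\<close> and so has trace 0.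
\<close>

lemma anticommuting_multiple_with_trace_2:
  fixes T W :: "'a::field ^ 2 ^ 2"
  assumes two: "(2::'a) \<noteq> 0" and T: "trace T = 0" "det T = 1" and W: "det W = 1"
    and M: "M = (trace W)\<^sup>2 + (trace (T ** W))\<^sup>2" "M \<noteq> 4" and s: "- M = s\<^sup>2"
  shows "\<exists>C. det C = 1 \<and> C ** T = - (T ** C) \<and> trace (C ** W) = 2"
proof -
  note four = four_neq_zero[OF two]
  define x y b where "x = trace W / 2" and "y = trace (T ** W) / 2" and "b = s / 2"
  have x: "trace W = 2 * x" and y: "trace (T ** W) = 2 * y"
    using two by (simp_all add: x_def y_def)
  define V U where "V = mat x + mat (- y) ** T" and "U = mat 1 + mat b ** T"
  define Y where "Y = W + mat (- x) + mat y ** T"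
  have WYV: "W = Y + V"
    by (cases W rule: mat2_exhaust; cases T rule: mat2_exhaust) (simp add: Y_def V_def mat2_simps)
  define d where "d = 1 - x\<^sup>2 - y\<^sup>2"
  have Md: "M = 4 * (x\<^sup>2 + y\<^sup>2)"
    unfolding M(1) x y by (simp add: power_mult_distrib algebra_simps)
  have d0: "d \<noteq> 0"
  proof
    assume "d = 0"
    then have "x\<^sup>2 + y\<^sup>2 = 1" by (simp add: d_def algebra_simps)
    then show False using Md M(2) by simp
  qed
  have "4 * b\<^sup>2 = s\<^sup>2" using four two by (simp add: b_def power_divide)
  also have "\<dots> = - (4 * (x\<^sup>2 + y\<^sup>2))" unfolding s[symmetric] Md ..
  finally have "4 * b\<^sup>2 = 4 * (- (x\<^sup>2 + y\<^sup>2))" by simp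
  then have "b\<^sup>2 = - (x\<^sup>2 + y\<^sup>2)" unfolding mult_cancel_left using four by simp
  then have detU: "det U = d"
    using mat_add_multiple(1)[OF T, of 1 b] by (simp add: U_def d_def)
  have detY: "det Y = d"
    unfolding Y_def mat_add_multiple(4)[OF T] W x y d_def
    by (simp add: power2_eq_square algebra_simps)
  have trY: "trace Y = 0"
    by (simp add: Y_def trace_add mat2_scalar(2-6) T x)
  have "T ** Y = T ** W + mat (- x) ** T + mat y ** (T ** T)"
    by (cases W rule: mat2_exhaust; cases T rule: mat2_exhaust)
      (simp add: Y_def mat2_simps algebra_simps)
  then have trTY: "trace (T ** Y) = 0"
    by (simp add: trace_add mat2_scalar(2-6) T y square_traceless)
  have YT: "Y ** T = - (T ** Y)"
    by (rule anticommute_if_traces_zero) (use T trY trTY in auto)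
  have UT: "U ** T = T ** U" unfolding U_def by (rule mat_add_multiple(2)[OF T])
  have neg: "A ** (- B) = - (A ** B)" for A B :: "'a ^ 2 ^ 2"
    by (cases A rule: mat2_exhaust; cases B rule: mat2_exhaust) (simp add: mat2_simps)
  define C where "C = mat (- 1 / d) ** (U ** Y)"
  have "det C = 1"
    using d0 by (simp add: C_def mat2_scalar(3,7) det_mul power_divide detU detY power2_eq_square)
  moreover have "C ** T = - (T ** C)"
  proof -
    have "C ** T = mat (- 1 / d) ** (U ** (Y ** T))"
      by (simp only: C_def matrix_mul_assoc)
    also have "U ** (Y ** T) = - ((U ** T) ** Y)"
      by (simp only: YT neg matrix_mul_assoc)
    also have "(U ** T) ** Y = T ** (U ** Y)"
      by (simp only: UT matrix_mul_assoc)
    also have "mat (- 1 / d) ** (- (T ** (U ** Y))) = - ((mat (- 1 / d) ** T) ** (U ** Y))"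
      by (simp only: neg matrix_mul_assoc)
    also have "mat (- 1 / d) ** T = T ** mat (- 1 / d)" by (simp only: mat2_scalar(1))
    finally show ?thesis by (simp only: C_def matrix_mul_assoc)
  qed
  moreover have "trace (C ** W) = 2"
  proof -
    have "(U ** Y) ** W = U ** (Y ** Y) + (U ** Y) ** V"
      by (simp add: WYV matrix_add_ldistrib matrix_mul_assoc)
    then have "trace ((U ** Y) ** W) = trace (U ** (Y ** Y)) + trace ((U ** Y) ** V)"
      by (simp add: trace_add)
    also have "U ** (Y ** Y) = mat (- d) ** U"
      by (simp only: square_traceless[OF trY] detY mat2_scalar(1))
    also have "trace \<dots> = - (2 * d)"
      by (simp add: mat2_scalar(2-6)) (simp add: U_def trace_add mat2_scalar(2-6) T)
    also have "trace ((U ** Y) ** V) = trace ((V ** U) ** Y)"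
      by (metis trace_mul_sym matrix_mul_assoc)
    also have "\<dots> = 0"
      unfolding V_def U_def mat_add_multiple(5)[OF T] mat_add_multiple(3)[OF T] trY trTY by simp
    finally have "trace ((U ** Y) ** W) = - (2 * d)" by simp
    moreover have "trace (C ** W) = - 1 / d * trace ((U ** Y) ** W)"
      by (simp only: C_def mat2_scalar(2) flip: matrix_mul_assoc)
    ultimately show ?thesis using d0 by simp
  qed
  ultimately show ?thesis by blast
qed

text \<open>
  The matrices \<open>C\<close> that commute or anticommute with \<open>T\<close> are the lifts of the elements of the centralizer
  of the class of \<open>T\<close>, so this is the theorem in terms of matrices. The proof matches the traces that
  occur with those that force odd order.
\<close>

lemma exists_odd_order_multiple:
  fixes T W :: "'a::{field,finite} ^ 2 ^ 2"
  assumes pp: "primepow CARD('a)" and T: "det T = 1" "T ** T = - mat 1"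
    and W: "det W = 1"
  shows "\<exists>C. det C = 1 \<and> (C ** T = T ** C \<or> C ** T = - (T ** C)) \<and> odd_order_mod_sign (C ** W)"
proof -
  have trT: "trace T = 0" by (rule trace_zero_if_square_minus_one[OF T(1,2)])
  note T0 = trT T(1)
  define x y where "x = trace W" and "y = trace (T ** W)"
  define M where "M = x\<^sup>2 + y\<^sup>2"
  have M_traces: "M = (trace W)\<^sup>2 + (trace (T ** W))\<^sup>2" by (simp add: M_def x_def y_def)
  have det1: "det (C ** W) = 1" if "det C = 1" for C using that W by (simp add: det_mul)
  have "even CARD('a) \<or> CARD('a) mod 4 = 1 \<or> CARD('a) mod 4 = 3" by presburger
  then consider "even CARD('a)" | "CARD('a) mod 4 = 1" | "CARD('a) mod 4 = 3" by blast
  then show ?thesis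
  proof cases
    case 1
    have two: "(2::'a) = 0" using two_eq_zero_iff_even_CARD[OF pp] 1 by simp
    then have minus: "- z = z" for z :: 'a
      by (metis add.right_inverse eq_neg_iff_add_eq_0 mult_2 mult_zero_left)
    consider "x \<noteq> 0" | "y \<noteq> 0" | "x = 0" "y = 0" by blast
    then show ?thesis
    proof cases
      case 1
      then have "odd_order_mod_sign W"
        using odd_order_even_CARD[OF pp \<open>even CARD('a)\<close> W] by (simp add: x_def)
      then show ?thesis by (intro exI[of _ "mat 1"]) simp
    next
      case 2
      then have "odd_order_mod_sign (T ** W)"
        using odd_order_even_CARD[OF pp \<open>even CARD('a)\<close> det1[OF T(1)]] by (simp add: y_def)
      then show ?thesis using T(1) by blast
    next
      case 3
      then have "W ** T = - (T ** W)" and tr: "trace W = 0"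
        using anticommute_if_traces_zero[OF trT] by (simp_all add: x_def y_def)
      \<comment> \<open>The class of \<open>W\<close> lies in the centralizer, so the coset contains the identity.\<close>
      moreover have "odd_order_mod_sign (W ** W)"
      proof -
        have "W ** W = mat 1"
          using square_traceless[OF tr] W by (simp add: minus)
        then have "(W ** W) [^]\<^bsub>SL\<^esub> (1::nat) = mat 1" by simp
        moreover have "odd (1::nat)" by simp
        ultimately show ?thesis unfolding odd_order_mod_sign_def by blast
      qed
      ultimately show ?thesis using W by blast
    qed
  next
    case 2
    then have od: "odd CARD('a)" by presburger
    have two: "(2::'a) \<noteq> 0" using two_eq_zero_iff_even_CARD[OF pp] od by simp
    note four = four_neq_zero[OF two]
    obtain i :: 'a where i: "i\<^sup>2 = - 1" using minus_one_square[OF two 2] .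
    \<comment> \<open>The first case covers \<open>M = 0\<close> and the second case covers \<open>M = 4\<close>, both with \<open>s = 0\<close>.\<close>
    consider s where "- M = s\<^sup>2" "M \<noteq> 4" | s where "M - 4 = s\<^sup>2" "M \<noteq> 0"
      | "\<And>s. M \<noteq> s\<^sup>2" "\<And>s. M - 4 \<noteq> s\<^sup>2"
    proof -
      assume hyp: "\<And>s. - M = s\<^sup>2 \<Longrightarrow> M \<noteq> 4 \<Longrightarrow> thesis"
        "\<And>s. M - 4 = s\<^sup>2 \<Longrightarrow> M \<noteq> 0 \<Longrightarrow> thesis"
        "(\<And>s. M \<noteq> s\<^sup>2) \<Longrightarrow> (\<And>s. M - 4 \<noteq> s\<^sup>2) \<Longrightarrow> thesis"
      show thesis
      proof (cases "M = 0 \<or> M = 4")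
        case True
        then show thesis using hyp(1)[of 0] hyp(2)[of 0] four by auto
      next
        case False
        have "- M = (i * s)\<^sup>2" if "M = s\<^sup>2" for s using that i by (simp add: power_mult_distrib)
        then show thesis using hyp False by blast
      qed
    qed
    then show ?thesis
    proof cases
      case (1 s)
      then show ?thesis
        using anticommuting_multiple_with_trace_2[OF two T0 W M_traces] det1
          odd_order_unipotent[OF pp od] by metis
    next
      case (2 s)
      have "2\<^sup>2 + s\<^sup>2 = M" by (simp flip: 2(1))
      then show ?thesis
        using commuting_multiple_with_trace[OF T0 M_traces 2(2)] det1
          odd_order_unipotent[OF pp od] by metis
    next
      case 3
      then obtain t s where "t\<^sup>2 + s\<^sup>2 = M" "\<forall>r. t\<^sup>2 - 4 \<noteq> r\<^sup>2"
        using exists_elliptic_trace[OF two \<open>CARD('a) mod 4 = 1\<close>, of M] by blast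
      moreover have "M \<noteq> 0" using 3(1)[of 0] by simp
      ultimately show ?thesis
        using commuting_multiple_with_trace[OF T0 M_traces] det1
          odd_order_CARD_1_mod_4[OF pp \<open>CARD('a) mod 4 = 1\<close>] by metis
    qed
  next
    case 3
    then have od: "odd CARD('a)" by presburger
    have two: "(2::'a) \<noteq> 0" using two_eq_zero_iff_even_CARD[OF pp] od by simp
    note four = four_neq_zero[OF two]
    show ?thesis
    proof (cases "M = 0")
      case True
      then have "M \<noteq> 4" "- M = 0\<^sup>2" using four by auto
      then show ?thesis
        using anticommuting_multiple_with_trace_2[OF two T0 W M_traces] det1
          odd_order_unipotent[OF pp od] by metis
    next
      case False
      then obtain t s r where "t\<^sup>2 + s\<^sup>2 = M" "t\<^sup>2 - 4 = r\<^sup>2"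
        using exists_hyperbolic_trace[OF two 3] by blast
      then show ?thesis
        using commuting_multiple_with_trace[OF T0 M_traces False] det1
          odd_order_CARD_3_mod_4[OF pp 3] by metis
    qed
  qed
qed

section \<open>Passage to PSL(2,q)\<close>

lemma group_center_SL2:
  "group_center (SL :: ('a::field ^ 2 ^ 2) monoid) = {mat 1, - mat 1}"
proof (intro subset_antisym subsetI)
  fix Z :: "'a ^ 2 ^ 2" assume Z: "Z \<in> group_center SL"
  obtain a b c d where abcd: "Z = mat2 a b c d" by (rule mat2_exhaust)
  have "Z ** mat2 1 1 0 1 = mat2 1 1 0 1 ** Z" "Z ** mat2 1 0 1 1 = mat2 1 0 1 1 ** Z"
    and "det Z = 1"
    using Z by (simp_all add: group_center_def mat2_simps)
  then have "c = 0" "b = 0" "a = d" "a * d = 1"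
    by (auto simp: abcd mat2_simps)
  then show "Z \<in> {mat 1, - mat 1}"
    by (auto simp: abcd mat2_simps square_eq_1_iff)
next
  fix Z :: "'a ^ 2 ^ 2" assume "Z \<in> {mat 1, - mat 1}"
  then have Z: "Z = mat2 1 0 0 1 \<or> Z = mat2 (- 1) 0 0 (- 1)" by (auto simp: mat2_simps)
  have "Z ** g = g ** Z" for g
    using Z by (cases g rule: mat2_exhaust) (auto simp: mat2_simps)
  moreover have "det Z = 1" using Z by (auto simp: mat2_simps)
  ultimately show "Z \<in> group_center SL" by (simp add: group_center_def)
qed

abbreviation PSL_class :: "'a::field ^ 2 ^ 2 \<Rightarrow> ('a ^ 2 ^ 2) set" where
  "PSL_class A \<equiv> group_center SL #>\<^bsub>SL\<^esub> A"

lemma PSL_class_hom: "group_hom SL PSL (PSL_class :: 'a::field ^ 2 ^ 2 \<Rightarrow> _)"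
  by (intro group_hom.intro group_SL group_PSL group_hom_axioms.intro)
    (simp add: PSL_def normal.r_coset_hom_Mod group_center_normal group_SL)

lemma PSL_class_surj:
  assumes "t \<in> carrier (PSL :: ('a::field ^ 2 ^ 2) set monoid)"
  obtains T where "det T = 1" "t = PSL_class T"
  using assms by (auto simp: PSL_def FactGroup_def RCOSETS_def)

lemma PSL_class_uminus: "PSL_class (- A) = PSL_class A"
proof -
  have "- mat 1 ** A = - A"
    by (cases A rule: mat2_exhaust) (simp add: mat2_simps)
  moreover have "mat 1 ** (- A) = - A" "- mat 1 ** (- A) = A"
    by (cases A rule: mat2_exhaust, simp add: mat2_simps)+
  ultimately show ?thesis
    by (auto simp: r_coset_def group_center_SL2)
qed

lemma PSL_class_eq_one_iff:
  assumes "det A = 1"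
  shows "PSL_class A = \<one>\<^bsub>PSL\<^esub> \<longleftrightarrow> A = mat 1 \<or> A = - mat (1 :: 'a::field)"
proof -
  have "subgroup (group_center SL) (SL :: ('a ^ 2 ^ 2) monoid)"
    using group_center_normal[OF group_SL] by (rule normal_imp_subgroup)
  moreover have "A \<in> carrier SL" using assms by simp
  ultimately have "PSL_class A = group_center SL \<longleftrightarrow> A \<in> group_center SL"
    by (metis SL.coset_join1 SL.coset_join2)
  then show ?thesis by (simp add: PSL_def FactGroup_def group_center_SL2)
qed

theorem theorem1p2:
  fixes q :: nat
    and G :: "('a::{field,finite} ^ 2 ^ 2) set monoid"
    and t x :: "('a ^ 2 ^ 2) set"
  assumes "primepow q"
    and "CARD('a) = q"
    and "G = PSL"
    and "t \<in> carrier G"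
    and "group.ord G t = 2"
    and "x \<in> carrier G"
  shows "\<exists>g \<in> element_centralizer G t #>\<^bsub>G\<^esub> x. odd (group.ord G g)"
proof -
  have pp: "primepow CARD('a)" using assms by simp
  interpret \<pi>: group_hom SL "PSL :: ('a ^ 2 ^ 2) set monoid" PSL_class
    by (rule PSL_class_hom)
  have \<pi>_mult: "PSL_class A \<otimes>\<^bsub>PSL\<^esub> PSL_class B = PSL_class (A ** B)"
    if "det A = 1" "det B = 1" for A B :: "'a ^ 2 ^ 2"
    using \<pi>.hom_mult[of A B] that by simp
  obtain T where T: "det T = 1" "t = PSL_class T"
    using PSL_class_surj assms(3,4) by blast
  obtain W where W: "det W = 1" "x = PSL_class W"
    using PSL_class_surj assms(3,6) by blast
  have t: "t \<in> carrier PSL" "\<pi>.H.ord t = 2" using assms(3-5) by simp_all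
  have "t [^]\<^bsub>PSL\<^esub> (2::nat) = \<one>\<^bsub>PSL\<^esub>"
    using \<pi>.H.pow_ord_eq_1[OF t(1)] t(2) by simp
  then have "t \<otimes>\<^bsub>PSL\<^esub> t = \<one>\<^bsub>PSL\<^esub>"
    using t(1) by (simp add: numeral_2_eq_2)
  then have sq: "T ** T = mat 1 \<or> T ** T = - mat 1"
    using PSL_class_eq_one_iff[of "T ** T"] T by (simp add: \<pi>_mult det_mul)
  have "t \<noteq> \<one>\<^bsub>PSL\<^esub>" using t(2) \<pi>.H.ord_eq_1[OF t(1)] by auto
  then have T1: "T \<noteq> mat 1" "T \<noteq> - mat 1"
    using PSL_class_eq_one_iff[OF T(1)] T(2) by auto
  have T2: "T ** T = - mat 1"
  proof (cases "(2::'a) = 0")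
    case True
    then have "(- 1 :: 'a) = 1"
      by (metis add_eq_0_iff one_add_one)
    then have "- (mat 1 :: 'a ^ 2 ^ 2) = mat 1" by (metis mat2_scalar(5))
    then show ?thesis using sq by metis
  next
    case False
    then show ?thesis using sq square_eq_one_SL2[OF False T(1)] T1 by blast
  qed
  obtain C where C: "det C = 1" "C ** T = T ** C \<or> C ** T = - (T ** C)"
      "odd_order_mod_sign (C ** W)"
    using exists_odd_order_multiple[OF pp T(1) T2 W(1)] by blast
  have "PSL_class (C ** T) = PSL_class (T ** C)"
    using C(2) PSL_class_uminus by metis
  then have "PSL_class C \<in> element_centralizer PSL t"
    using \<pi>.hom_closed[of C] C(1) T by (simp add: element_centralizer_def \<pi>_mult)
  then have "PSL_class C \<otimes>\<^bsub>PSL\<^esub> x \<in> element_centralizer PSL t #>\<^bsub>PSL\<^esub> x"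
    using assms(3,6) by (intro \<pi>.H.rcosI) (auto simp: element_centralizer_def)
  then have mem: "PSL_class (C ** W) \<in> element_centralizer PSL t #>\<^bsub>PSL\<^esub> x"
    using \<pi>_mult[OF C(1) W(1)] W(2) by simp
  obtain m :: nat where m: "odd m"
      "(C ** W) [^]\<^bsub>SL\<^esub> m = mat 1 \<or> (C ** W) [^]\<^bsub>SL\<^esub> m = - mat 1"
    using C(3) unfolding odd_order_mod_sign_def by blast
  have CW: "C ** W \<in> carrier SL" using C(1) W(1) by (simp add: det_mul)
  have "PSL_class (C ** W) [^]\<^bsub>PSL\<^esub> m = PSL_class ((C ** W) [^]\<^bsub>SL\<^esub> m)"
    using \<pi>.hom_nat_pow[OF CW] by simp
  also have "\<dots> = \<one>\<^bsub>PSL\<^esub>"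
    using PSL_class_eq_one_iff[of "(C ** W) [^]\<^bsub>SL\<^esub> m"] SL.nat_pow_closed[OF CW, of m] m(2)
    by simp
  finally have "\<pi>.H.ord (PSL_class (C ** W)) dvd m"
    using \<pi>.H.pow_eq_id[OF \<pi>.hom_closed[OF CW]] by simp
  then have "odd (\<pi>.H.ord (PSL_class (C ** W)))"
    using m(1) dvd_trans by blast
  then show ?thesis using mem assms(3) by blast
qed

end
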